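(* Let $\alpha\in(0,1)$, $\beta\in(0,1-\alpha)$, let $D\ge 1$ be an integer (with $D\le N$ when $J=\{1,\dots,N\}$), and set $$c(\alpha,\beta)=\bigl(2\ln(1+4(1-\alpha-\beta)^2)\bigr)^{1/2},\qquad \rho_D^2=c(\alpha,\beta)\Bigl(\sum_{j=1}^D\sigma_j^4\Bigr)^{1/2},\qquad S_D=\{\theta\in l_2(J):\ \theta_j=0\ \text{for all } j>D\}.$$ Then, for every $0<\rho\le\rho_D$, $$\inf_{\Phi_\alpha}\ \sup_{\theta\in S_D,\ \|\theta\|_2=\rho}\mathbb{P}_\theta(\Phi_\alpha=0)\ \ge\ \beta,$$ where the infimum is over all level-$\alpha$ tests $\Phi_\alpha$ of the null hypothesis "$\theta=0$". Consequently $\rho_2(S_D,\alpha,\beta)\ge\rho_D$.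
   Context: Model: $J=\{1,\dots,N\}$ for some integer $N\ge1$, or $J=\{1,2,3,\dots\}$. One observes $Y=(Y_j)_{j\in J}$ with $Y_j=\theta_j+\sigma_j\epsilon_j$, where $\theta=(\theta_j)_{j\in J}$ is unknown, $\sigma_j>0$ are known, and $(\epsilon_j)_{j\in J}$ are i.i.d. standard normal. $\mathbb{P}_\theta$ is the distribution of $Y$. $\|\theta\|_2^2=\sum_{j\in J}\theta_j^2$. A test is a measurable function $\Phi$ of $Y$ with values in $\{0,1\}$; the null hypothesis "$\theta=0$" is rejected iff $\Phi=1$. It has level $\alpha$ if $\mathbb{P}_0(\Phi=1)\le\alpha$. For $\mathcal{F}\subset l_2(J)$ and a level-$\alpha$ test $\Phi_\alpha$, $\rho_2(\Phi_\alpha,\mathcal{F},\beta)=\inf\{\rho>0:\ \inf_{\theta\in\mathcal{F},\|\theta\|_2\ge\rho}\mathbb{P}_\theta(\Phi_\alpha=1)>1-\beta\}$, and the $(\alpha,\beta)$ minimax rate of testing $\rho_2(\mathcal{F},\alpha,\beta)$ is the infimum of $\rho_2(\Phi_\alpha,\mathcal{F},\beta)$ over all level-$\alpha$ tests $\Phi_\alpha$. *)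

theory Defs
  imports "HOL-Probability.Probability"
begin

text \<open>
  Sequences indexed by \<open>J\<close> are functions on \<open>nat\<close> that are \<open>undefined\<close> outside \<open>J\<close>;
  measurability refers to the product Borel sigma-algebra.
\<close>

abbreviation seq_space :: "nat set \<Rightarrow> (nat \<Rightarrow> real) measure" where
  "seq_space J \<equiv> Pi\<^sub>M J (\<lambda>_. borel)"

definition noise_law :: "nat set \<Rightarrow> (nat \<Rightarrow> real) measure" where
  "noise_law J = Pi\<^sub>M J (\<lambda>_. density lborel (\<lambda>x. ennreal (std_normal_density x)))"

definition obs_law :: "nat set \<Rightarrow> (nat \<Rightarrow> real) \<Rightarrow> (nat \<Rightarrow> real) \<Rightarrow> (nat \<Rightarrow> real) measure" where
  "obs_law J \<sigma> \<theta> = distr (noise_law J) (seq_space J) (\<lambda>\<epsilon>. \<lambda>j\<in>J. \<theta> j + \<sigma> j * \<epsilon> j)"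

text \<open>
  Taking the noise on its canonical space loses no generality: i.i.d. standard normal noise
  on any probability space gives the same distribution of the observations.
\<close>

lemma (in prob_space) distr_obs_eq_obs_law:
  assumes "J \<noteq> {}"
    and indep: "indep_vars (\<lambda>_. borel) \<epsilon> J"
    and normal: "\<And>j. j \<in> J \<Longrightarrow> distributed M lborel (\<epsilon> j) std_normal_density"
  shows "distr M (seq_space J) (\<lambda>\<omega>. \<lambda>j\<in>J. \<theta> j + \<sigma> j * \<epsilon> j \<omega>) = obs_law J \<sigma> \<theta>"
proof -
  have rv: "\<epsilon> j \<in> borel_measurable M" if "j \<in> J" for j
    using indep that by (auto simp: indep_vars_def)
  have "distr M (seq_space J) (\<lambda>\<omega>. \<lambda>j\<in>J. \<epsilon> j \<omega>) = Pi\<^sub>M J (\<lambda>j. distr M borel (\<epsilon> j))"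
    using indep_vars_iff_distr_eq_PiM'[where I = J and X = \<epsilon> and M' = "\<lambda>_. borel"] assms(1) rv indep by simp
  also have "\<dots> = noise_law J"
    unfolding noise_law_def
  proof (rule PiM_cong)
    fix j assume "j \<in> J"
    have "distr M borel (\<epsilon> j) = distr M lborel (\<epsilon> j)"
      by (rule distr_cong) auto
    then show "distr M borel (\<epsilon> j) = density lborel (\<lambda>x. ennreal (std_normal_density x))"
      using normal[OF \<open>j \<in> J\<close>] by (simp add: distributed_def)
  qed simp
  finally have noise: "distr M (seq_space J) (\<lambda>\<omega>. \<lambda>j\<in>J. \<epsilon> j \<omega>) = noise_law J" .
  have "obs_law J \<sigma> \<theta> = distr M (seq_space J)
      ((\<lambda>e. \<lambda>j\<in>J. \<theta> j + \<sigma> j * e j) \<circ> (\<lambda>\<omega>. \<lambda>j\<in>J. \<epsilon> j \<omega>))"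
    unfolding obs_law_def noise[symmetric]
    by (rule distr_distr) (auto intro!: measurable_restrict rv)
  also have "(\<lambda>e. \<lambda>j\<in>J. \<theta> j + \<sigma> j * e j) \<circ> (\<lambda>\<omega>. \<lambda>j\<in>J. \<epsilon> j \<omega>)
      = (\<lambda>\<omega>. \<lambda>j\<in>J. \<theta> j + \<sigma> j * \<epsilon> j \<omega>)"
    by (auto simp: fun_eq_iff)
  finally show ?thesis by (rule sym)
qed

definition l2_space :: "nat set \<Rightarrow> (nat \<Rightarrow> real) set" where
  "l2_space J = {\<theta> \<in> extensional J. (\<lambda>j. (\<theta> j)\<^sup>2) summable_on J}"

definition l2_norm :: "nat set \<Rightarrow> (nat \<Rightarrow> real) \<Rightarrow> real" where
  "l2_norm J \<theta> = sqrt (\<Sum>\<^sub>\<infinity>j\<in>J. (\<theta> j)\<^sup>2)"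

definition tests :: "nat set \<Rightarrow> ((nat \<Rightarrow> real) \<Rightarrow> nat) set" where
  "tests J = seq_space J \<rightarrow>\<^sub>M count_space {0, 1}"

definition test_prob ::
  "nat set \<Rightarrow> (nat \<Rightarrow> real) \<Rightarrow> (nat \<Rightarrow> real) \<Rightarrow> ((nat \<Rightarrow> real) \<Rightarrow> nat) \<Rightarrow> nat \<Rightarrow> real" where
  "test_prob J \<sigma> \<theta> \<Phi> i = measure (obs_law J \<sigma> \<theta>) {y \<in> space (obs_law J \<sigma> \<theta>). \<Phi> y = i}"

definition level_tests :: "nat set \<Rightarrow> (nat \<Rightarrow> real) \<Rightarrow> real \<Rightarrow> ((nat \<Rightarrow> real) \<Rightarrow> nat) set" where
  "level_tests J \<sigma> \<alpha> = {\<Phi> \<in> tests J. test_prob J \<sigma> (\<lambda>j\<in>J. 0) \<Phi> 1 \<le> \<alpha>}"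

text \<open>
  The infima are taken in the extended reals, so that the infimum over an empty set is
  \<open>\<infinity>\<close>; for instance, the separation radius of a test that never attains power
  above \<open>1 - \<beta>\<close> uniformly is \<open>\<infinity>\<close>.
\<close>

definition test_radius ::
  "nat set \<Rightarrow> (nat \<Rightarrow> real) \<Rightarrow> ((nat \<Rightarrow> real) \<Rightarrow> nat) \<Rightarrow> (nat \<Rightarrow> real) set \<Rightarrow> real \<Rightarrow> ereal" where
  "test_radius J \<sigma> \<Phi> F \<beta> = (INF \<rho> \<in> {\<rho>. 0 < \<rho> \<and>
     (INF \<theta> \<in> {\<theta> \<in> F. \<rho> \<le> l2_norm J \<theta>}. ereal (test_prob J \<sigma> \<theta> \<Phi> 1)) > ereal (1 - \<beta>)}. ereal \<rho>)"

definition minimax_rate ::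
  "nat set \<Rightarrow> (nat \<Rightarrow> real) \<Rightarrow> (nat \<Rightarrow> real) set \<Rightarrow> real \<Rightarrow> real \<Rightarrow> ereal" where
  "minimax_rate J \<sigma> F \<alpha> \<beta> = (INF \<Phi> \<in> level_tests J \<sigma> \<alpha>. test_radius J \<sigma> \<Phi> F \<beta>)"

definition S_set :: "nat set \<Rightarrow> nat \<Rightarrow> (nat \<Rightarrow> real) set" where
  "S_set J D = {\<theta> \<in> l2_space J. \<forall>j\<in>J. j > D \<longrightarrow> \<theta> j = 0}"

definition c_const :: "real \<Rightarrow> real \<Rightarrow> real" where
  "c_const \<alpha> \<beta> = sqrt (2 * ln (1 + 4 * (1 - \<alpha> - \<beta>)\<^sup>2))"

definition rho_D :: "(nat \<Rightarrow> real) \<Rightarrow> real \<Rightarrow> real \<Rightarrow> nat \<Rightarrow> real" where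
  "rho_D \<sigma> \<alpha> \<beta> D = sqrt (c_const \<alpha> \<beta> * sqrt (\<Sum>j=1..D. \<sigma> j ^ 4))"

end

theory Submission
  imports Defs
begin

text \<open>
  The proof is Ingster's second moment method. Instead of one alternative, the test is confronted
  with a uniform mixture of \<open>2 ^ D\<close> of them, all of norm exactly \<open>\<rho>\<close>: the signals
  \<open>\<theta> j = s j * \<sigma> j ^ 2 * \<rho> / sqrt V\<close> with \<open>V = (\<Sum>j=1..D. \<sigma> j ^ 4)\<close> and signs
  \<open>s j \<in> {-1, 1}\<close>. A test whose type II error were below \<open>\<beta>\<close> at each of them would have
  type II error below \<open>\<beta>\<close> under the mixture, so it suffices to show that the mixture
  cannot be told apart from the null hypothesis.

  After division by \<open>\<sigma> j\<close> the alternatives shift the standard normal noise by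
  \<open>s j * a j\<close>, where \<open>a j = \<sigma> j * \<rho> / sqrt V\<close>. A shift of finitely many coordinates of the noise
  law has a density (\<open>noise_law_shift\<close>), a product of the one-dimensional
  Gaussian likelihood ratios \<open>exp (b * x - b ^ 2 / 2)\<close>. Averaging over independent signs turns the
  likelihood ratio \<open>L\<close> of the mixture into a product over the coordinates
  (\<open>prod_sym_lr_eq_average\<close>), whose second moment is
  \<open>(\<Prod>j=1..D. cosh (a j ^ 2)) \<le> exp ((\<Sum>j=1..D. a j ^ 4) / 2) = exp (\<rho> ^ 4 / (2 * V))\<close>.
  The radius \<open>rho_D\<close> is the one at which this bound reaches \<open>1 + 4 * (1 - \<alpha> - \<beta>) ^ 2\<close>.

  Finally, half the \<open>L\<^sup>1\<close> distance of \<open>L\<close> from \<open>1\<close> bounds the change in probability of any event,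
  and Cauchy-Schwarz bounds it by half the square root of the variance of \<open>L\<close>
  (\<open>prob_diff_le_half_second_moment\<close>), hence by \<open>1 - \<alpha> - \<beta>\<close>. The null hypothesis is
  accepted with probability at least \<open>1 - \<alpha>\<close> when it is true, hence with probability at least
  \<open>\<beta>\<close> under the mixture.

  The bound on the minimax rate follows: a separation radius below \<open>rho_D\<close> would require power
  above \<open>1 - \<beta>\<close> also on the sphere of that radius, which has just been excluded.
\<close>

section \<open>Infinite products of probability measures\<close>

text \<open>
  A function of finitely many coordinates is integrated against the marginal on those coordinates,
  which is a finite product; this reduces the claim, and its Bochner analogue, to Fubini's theorem.
\<close>

lemma (in product_prob_space) nn_integral_prod_coordinates:
  assumes K: "finite K" "K \<subseteq> I" and f: "\<And>j. j \<in> K \<Longrightarrow> f j \<in> borel_measurable (M j)"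
  shows "(\<integral>\<^sup>+ x. (\<Prod>j\<in>K. f j (x j)) \<partial>PiM I M) = (\<Prod>j\<in>K. \<integral>\<^sup>+ y. f j y \<partial>M j)"
proof -
  have "(\<integral>\<^sup>+ x. (\<Prod>j\<in>K. f j (x j)) \<partial>PiM I M)
      = (\<integral>\<^sup>+ x. (\<Prod>j\<in>K. f j (restrict x K j)) \<partial>PiM I M)"
    by (intro nn_integral_cong prod.cong) auto
  also have "\<dots> = (\<integral>\<^sup>+ x. (\<Prod>j\<in>K. f j (x j)) \<partial>distr (PiM I M) (PiM K M) (\<lambda>x. restrict x K))"
    using K f by (subst nn_integral_distr)
      (auto intro!: measurable_restrict_subset borel_measurable_prod measurable_compose[OF measurable_component_singleton])
  also have "\<dots> = (\<Prod>j\<in>K. \<integral>\<^sup>+ y. f j y \<partial>M j)"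
    unfolding distr_PiM_restrict_finite[OF K] using K f by (intro product_nn_integral_prod) auto
  finally show ?thesis .
qed

lemma (in product_prob_space)
  fixes f :: "'i \<Rightarrow> 'a \<Rightarrow> real"
  assumes K: "finite K" "K \<subseteq> I" and f: "\<And>j. j \<in> K \<Longrightarrow> integrable (M j) (f j)"
  shows integrable_prod_coordinates: "integrable (PiM I M) (\<lambda>x. \<Prod>j\<in>K. f j (x j))"
    and integral_prod_coordinates:
      "(\<integral>x. (\<Prod>j\<in>K. f j (x j)) \<partial>PiM I M) = (\<Prod>j\<in>K. \<integral>y. f j y \<partial>M j)"
proof -
  have r: "(\<lambda>x. restrict x K) \<in> PiM I M \<rightarrow>\<^sub>M PiM K M"
    using K by (intro measurable_restrict_subset)
  have i: "integrable (distr (PiM I M) (PiM K M) (\<lambda>x. restrict x K)) (\<lambda>x. \<Prod>j\<in>K. f j (x j))"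
    unfolding distr_PiM_restrict_finite[OF K] using K f by (intro product_integrable_prod)
  have restrict: "(\<Prod>j\<in>K. f j (restrict x K j)) = (\<Prod>j\<in>K. f j (x j))" for x
    by (intro prod.cong) auto
  show "integrable (PiM I M) (\<lambda>x. \<Prod>j\<in>K. f j (x j))"
    using integrable_distr[OF r i] by (simp only: restrict)
  have "(\<integral>x. (\<Prod>j\<in>K. f j (x j)) \<partial>PiM I M)
      = (\<integral>x. (\<Prod>j\<in>K. f j (x j)) \<partial>distr (PiM I M) (PiM K M) (\<lambda>x. restrict x K))"
    using integral_distr[OF r, of "\<lambda>x. \<Prod>j\<in>K. f j (x j)"] i
    by (simp only: restrict borel_measurable_integrable distr_PiM_restrict_finite[OF K])
  also have "\<dots> = (\<Prod>j\<in>K. \<integral>y. f j y \<partial>M j)"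
    unfolding distr_PiM_restrict_finite[OF K] using K f by (intro product_integral_prod)
  finally show "(\<integral>x. (\<Prod>j\<in>K. f j (x j)) \<partial>PiM I M) = (\<Prod>j\<in>K. \<integral>y. f j y \<partial>M j)" .
qed

lemma distr_PiM_coordinatewise:
  assumes M: "\<And>j. j \<in> I \<Longrightarrow> prob_space (M j)"
    and g: "\<And>j. j \<in> I \<Longrightarrow> g j \<in> M j \<rightarrow>\<^sub>M N j"
  shows "distr (PiM I M) (PiM I N) (\<lambda>x. \<lambda>j\<in>I. g j (x j)) = PiM I (\<lambda>j. distr (M j) (N j) (g j))"
proof (rule measure_eqI_PiM_infinite[symmetric, OF refl])
  let ?D = "\<lambda>j. distr (M j) (N j) (g j)"
  have D: "prob_space (?D j)" if "j \<in> I" for j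
    using M g that by (intro prob_space.prob_space_distr)
  have m: "(\<lambda>x. \<lambda>j\<in>I. g j (x j)) \<in> PiM I M \<rightarrow>\<^sub>M PiM I N"
    using g by (intro measurable_restrict) (auto intro: measurable_compose[OF measurable_component_singleton])
  show "finite_measure (PiM I ?D)"
    by (intro prob_space.finite_measure prob_space_PiM D)
  have s: "sets (PiM I ?D) = sets (PiM I N)"
    by (intro sets_PiM_cong) auto
  then show "sets (distr (PiM I M) (PiM I N) (\<lambda>x. \<lambda>j\<in>I. g j (x j))) = sets (PiM I ?D)"
    by simp
  fix A J assume J: "finite J" "J \<subseteq> I" and A: "\<And>j. j \<in> J \<Longrightarrow> A j \<in> sets (?D j)"
  let ?X = "prod_emb I ?D J (Pi\<^sub>E J A)" and ?B = "\<lambda>j. g j -` A j \<inter> space (M j)"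
  have X: "?X \<in> sets (PiM I N)"
    unfolding s[symmetric] using J A by (intro sets_PiM_I) auto
  have "(\<lambda>x. \<lambda>j\<in>I. g j (x j)) -` ?X \<inter> space (PiM I M) = prod_emb I M J (Pi\<^sub>E J ?B)"
    using J(2) g[THEN measurable_space] by (auto simp: prod_emb_def space_PiM PiE_iff subset_iff)
  then have "emeasure (distr (PiM I M) (PiM I N) (\<lambda>x. \<lambda>j\<in>I. g j (x j))) ?X
      = emeasure (PiM I M) (prod_emb I M J (Pi\<^sub>E J ?B))"
    using emeasure_distr[OF m X] by simp
  also have "\<dots> = (\<Prod>j\<in>J. emeasure (M j) (?B j))"
    using J A g by (intro emeasure_PiM_emb M measurable_sets) auto
  also have "\<dots> = (\<Prod>j\<in>J. emeasure (?D j) (A j))"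
    using J A g by (intro prod.cong refl) (auto simp: emeasure_distr subset_iff)
  also have "\<dots> = emeasure (PiM I ?D) ?X"
    using J A by (intro emeasure_PiM_emb[symmetric] D) auto
  finally show "emeasure (PiM I ?D) ?X = emeasure (distr (PiM I M) (PiM I N) (\<lambda>x. \<lambda>j\<in>I. g j (x j))) ?X"
    by (rule sym)
qed

text \<open>
  The factors equal to 1 off \<open>K\<close> allow \<open>K\<close> to be enlarged by the coordinates that a given
  cylinder set restricts. On that cylinder the measures on both sides are then the same finite
  product of one-dimensional integrals, and cylinders determine a probability measure on the product.
\<close>

lemma (in product_prob_space) density_PiM_coordinates:
  assumes K: "finite K" "K \<subseteq> I"
    and f: "\<And>j. j \<in> I \<Longrightarrow> f j \<in> borel_measurable (M j)"
    and one: "\<And>j. j \<in> I \<Longrightarrow> (\<integral>\<^sup>+ y. f j y \<partial>M j) = 1"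
    and off: "\<And>j y. j \<in> I - K \<Longrightarrow> f j y = 1"
  shows "density (PiM I M) (\<lambda>x. \<Prod>j\<in>K. f j (x j)) = PiM I (\<lambda>j. density (M j) (f j))"
proof (rule measure_eqI_PiM_infinite[symmetric, OF refl])
  let ?D = "\<lambda>j. density (M j) (f j)"
  have D: "prob_space (?D j)" if "j \<in> I" for j
    using f[OF that] one[OF that]
    by (intro prob_spaceI) (simp add: emeasure_density cong: nn_integral_cong)
  show "finite_measure (PiM I ?D)"
    by (intro prob_space.finite_measure prob_space_PiM D)
  have s: "sets (PiM I ?D) = sets (PiM I M)"
    by (intro sets_PiM_cong) auto
  then show "sets (density (PiM I M) (\<lambda>x. \<Prod>j\<in>K. f j (x j))) = sets (PiM I ?D)"
    by simp
  have [measurable]: "(\<lambda>x. \<Prod>j\<in>K. f j (x j)) \<in> borel_measurable (PiM I M)"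
    using K f by (intro borel_measurable_prod_ennreal measurable_compose[OF measurable_component_singleton]) auto
  fix A J assume J: "finite J" "J \<subseteq> I" and A: "\<And>j. j \<in> J \<Longrightarrow> A j \<in> sets (?D j)"
  \<comment> \<open>Padding the cylinder with full factors lets one finite product range over \<open>K \<union> J\<close>.\<close>
  define B where "B j = (if j \<in> J then A j else space (M j))" for j
  let ?X = "prod_emb I ?D J (Pi\<^sub>E J A)"
  have X: "?X \<in> sets (PiM I M)"
    unfolding s[symmetric] using J A by (intro sets_PiM_I) auto
  have B: "B j \<in> sets (M j)" for j
    using A by (auto simp: B_def)
  have KJ: "finite (K \<union> J)" "K \<union> J \<subseteq> I" using K J by auto
  have eq: "(\<Prod>j\<in>K. f j (x j)) * indicator ?X x = (\<Prod>j\<in>K \<union> J. f j (x j) * indicator (B j) (x j))"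
    if x: "x \<in> space (PiM I M)" for x
  proof -
    have "(\<Prod>j\<in>K. f j (x j)) = (\<Prod>j\<in>K \<union> J. f j (x j))"
      using K J off by (intro prod.mono_neutral_left) auto
    moreover have "indicator ?X x = (\<Prod>j\<in>K \<union> J. indicator (B j) (x j) :: ennreal)"
    proof (cases "x \<in> ?X")
      case True
      then have "x j \<in> B j" if "j \<in> K \<union> J" for j
        using x K J that by (auto simp: prod_emb_def B_def space_PiM PiE_iff)
      with True show ?thesis by simp
    next
      case False
      then obtain j where "j \<in> J" "x j \<notin> B j"
        using x J by (auto simp: prod_emb_def B_def space_PiM PiE_iff)
      with False show ?thesis
        using KJ \<open>j \<in> J\<close> by (auto intro!: prod_zero[symmetric] bexI[of _ j])
    qed
    ultimately show ?thesis by (simp add: prod.distrib)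
  qed
  have "emeasure (density (PiM I M) (\<lambda>x. \<Prod>j\<in>K. f j (x j))) ?X
      = (\<integral>\<^sup>+ x. (\<Prod>j\<in>K \<union> J. f j (x j) * indicator (B j) (x j)) \<partial>PiM I M)"
    using X by (auto simp: emeasure_density eq intro!: nn_integral_cong)
  also have "\<dots> = (\<Prod>j\<in>K \<union> J. \<integral>\<^sup>+ y. f j y * indicator (B j) y \<partial>M j)"
    using KJ f B by (intro nn_integral_prod_coordinates) auto
  also have "\<dots> = (\<Prod>j\<in>K \<union> J. emeasure (?D j) (B j))"
    using KJ f B by (intro prod.cong refl) (auto simp: emeasure_density)
  also have "\<dots> = (\<Prod>j\<in>J. emeasure (?D j) (B j))"
  proof (intro prod.mono_neutral_right ballI)
    fix j assume "j \<in> K \<union> J - J"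
    then have "j \<in> I" "B j = space (?D j)" using K by (auto simp: B_def)
    then show "emeasure (?D j) (B j) = 1"
      using prob_space.emeasure_space_1[OF D, of j] by simp
  qed (use KJ in auto)
  also have "\<dots> = (\<Prod>j\<in>J. emeasure (?D j) (A j))"
    by (intro prod.cong) (auto simp: B_def)
  also have "\<dots> = emeasure (PiM I ?D) ?X"
    using J A by (intro Infinite_Product_Measure.emeasure_PiM_emb[symmetric] D) auto
  finally show "emeasure (PiM I ?D) ?X = emeasure (density (PiM I M) (\<lambda>x. \<Prod>j\<in>K. f j (x j))) ?X"
    by (rule sym)
qed

section \<open>The second moment method\<close>

text \<open>
  Since \<open>1 - L\<close> has mean 0, its integral over \<open>A\<close> is half its integral against the sign
  function \<open>s\<close> of \<open>A\<close>. The square of the latter integral is at most the second moment of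
  \<open>s * (1 - L)\<close>, which is the variance of \<open>L\<close>. Without symmetrization the factor 1/2, and with
  it the constant 4 in \<open>c_const\<close>, would be lost.
\<close>

lemma (in prob_space) prob_diff_le_half_second_moment:
  fixes L :: "'a \<Rightarrow> real"
  assumes L: "integrable M L" "integrable M (\<lambda>x. (L x)\<^sup>2)" "expectation L = 1"
    and A: "A \<in> events"
  shows "prob A - (\<integral>x\<in>A. L x \<partial>M) \<le> sqrt (expectation (\<lambda>x. (L x)\<^sup>2) - 1) / 2"
proof -
  define s where "s x = (if x \<in> A then 1 else - 1 :: real)" for x
  have [measurable]: "s \<in> borel_measurable M" "L \<in> borel_measurable M"
    using A L unfolding s_def by auto
  have abs_s: "\<bar>s x\<bar> = 1" for x
    by (simp add: s_def)
  have sq: "(s x * (1 - L x))\<^sup>2 = 1 - 2 * L x + (L x)\<^sup>2" for x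
    by (simp add: s_def power2_eq_square algebra_simps)
  have i1: "integrable M (\<lambda>x. s x * (1 - L x))"
    using L by (intro Bochner_Integration.integrable_bound[of M "\<lambda>x. 1 - L x" "\<lambda>x. s x * (1 - L x)"])
      (auto simp: abs_mult abs_s)
  have i2: "integrable M (\<lambda>x. (s x * (1 - L x))\<^sup>2)"
    unfolding sq using L by auto
  have ind: "indicator A x = (1 + s x) / 2" for x
    by (simp add: s_def indicator_def)
  have "0 \<le> variance (\<lambda>x. s x * (1 - L x))"
    by (rule variance_positive)
  then have "(expectation (\<lambda>x. s x * (1 - L x)))\<^sup>2 \<le> expectation (\<lambda>x. (s x * (1 - L x))\<^sup>2)"
    using variance_eq[OF i1 i2] by simp
  also have "\<dots> = expectation (\<lambda>x. (L x)\<^sup>2) - 1"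
    unfolding sq using L by (simp add: prob_space)
  finally have le: "expectation (\<lambda>x. s x * (1 - L x)) \<le> sqrt (expectation (\<lambda>x. (L x)\<^sup>2) - 1)"
    by (rule real_le_rsqrt)
  have "prob A - (\<integral>x\<in>A. L x \<partial>M) = expectation (\<lambda>x. indicator A x * (1 - L x))"
    using A L integrable_mult_indicator[OF A L(1)]
    by (simp add: set_lebesgue_integral_def right_diff_distrib Bochner_Integration.integral_diff emeasure_eq_measure)
  also have "\<dots> = expectation (\<lambda>x. ((1 - L x) + s x * (1 - L x)) / 2)"
    by (simp add: ind field_simps)
  also have "\<dots> = expectation (\<lambda>x. s x * (1 - L x)) / 2"
    using L i1 by (simp add: Bochner_Integration.integral_add prob_space)
  finally show ?thesis using le by simp
qed

text \<open>
  This is Hoeffding's lemma for a random sign, which has moment generating function \<open>cosh\<close>.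
\<close>

lemma cosh_le_exp_half_square:
  fixes x :: real
  shows "cosh x \<le> exp (x\<^sup>2 / 2)"
proof -
  have *: "cosh y \<le> exp (y\<^sup>2 / 2)" if "0 \<le> y" for y :: real
  proof -
    \<comment> \<open>A fair 0-1 variable is a random sign shifted and scaled by 1/2, whence \<open>2 * y\<close>.\<close>
    have "- (2 * y) * (1/2) + ln (1 + (1/2) * (exp (2 * y) - 1)) \<le> (2 * y)\<^sup>2 / 8"
      using that by (intro Hoeffdings_lemma_aux) auto
    also have "1 + (1/2) * (exp (2 * y) - 1) = exp y * cosh y"
      by (simp add: cosh_field_def field_simps flip: exp_add)
    finally have "ln (cosh y) \<le> y\<^sup>2 / 2"
      by (simp add: ln_mult power2_eq_square)
    then have "exp (ln (cosh y)) \<le> exp (y\<^sup>2 / 2)" by (simp only: exp_le_cancel_iff)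
    then show ?thesis by simp
  qed
  show ?thesis using *[of "\<bar>x\<bar>"] by simp
qed

section \<open>Gaussian likelihood ratios\<close>

text \<open>
The density of \<open>N(a, 1)\<close> with respect to \<open>N(0, 1)\<close>.
\<close>

definition shift_lr :: "real \<Rightarrow> real \<Rightarrow> real" where
  "shift_lr a x = exp (a * x - a\<^sup>2 / 2)"

lemma shift_lr_nonneg [simp]: "0 \<le> shift_lr a x"
  by (simp add: shift_lr_def)

lemma shift_lr_0 [simp]: "shift_lr 0 x = 1"
  by (simp add: shift_lr_def)

lemma borel_measurable_shift_lr [measurable]: "shift_lr a \<in> borel_measurable borel"
  unfolding shift_lr_def by measurable

lemma prob_space_std_normal: "prob_space std_normal_distribution"
  by (rule prob_space_normal_density) simp

text \<open>
  Together with the fact that a likelihood ratio has mean 1, this yields \<open>exp (a * b)\<close> as the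
  mean of a product of two of them.
\<close>

lemma shift_lr_mult: "shift_lr a x * shift_lr b x = exp (a * b) * shift_lr (a + b) x"
  by (simp add: shift_lr_def power2_eq_square field_simps flip: exp_add)

lemma std_normal_shift:
  "distr std_normal_distribution std_normal_distribution (\<lambda>x. a + x)
    = density std_normal_distribution (\<lambda>x. ennreal (shift_lr a x))"
proof (rule measure_eqI)
  fix A assume "A \<in> sets (distr std_normal_distribution std_normal_distribution (\<lambda>x. a + x))"
  then have [measurable]: "A \<in> sets borel" by simp
  have V: "(\<lambda>x. a + x) -` A \<in> sets borel"
    using measurable_sets[of "\<lambda>x. a + x" borel borel A] by simp
  have lr: "std_normal_density (x - a) = std_normal_density x * shift_lr a x" for x
    by (simp add: normal_density_def shift_lr_def power2_eq_square field_simps flip: exp_add)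
  have "emeasure (distr std_normal_distribution std_normal_distribution (\<lambda>x. a + x)) A
      = (\<integral>\<^sup>+x. ennreal (std_normal_density x) * indicator A (a + x) \<partial>lborel)"
    using V by (simp add: emeasure_distr emeasure_density indicator_def)
  also have "\<dots> = (\<integral>\<^sup>+x. ennreal (std_normal_density (x - a)) * indicator A x \<partial>lborel)"
    using nn_integral_real_affine[of "\<lambda>x. ennreal (std_normal_density x) * indicator A (a + x)" 1 "- a"]
    by simp
  also have "\<dots> = emeasure (density std_normal_distribution (\<lambda>x. ennreal (shift_lr a x))) A"
    by (simp add: emeasure_density nn_integral_density lr ennreal_mult mult.assoc cong: nn_integral_cong)
  finally show "emeasure (distr std_normal_distribution std_normal_distribution (\<lambda>x. a + x)) A
      = emeasure (density std_normal_distribution (\<lambda>x. ennreal (shift_lr a x))) A" .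
qed simp

lemma nn_integral_shift_lr: "(\<integral>\<^sup>+x. ennreal (shift_lr a x) \<partial>std_normal_distribution) = 1"
proof -
  interpret N: prob_space std_normal_distribution by (rule prob_space_std_normal)
  have "(\<integral>\<^sup>+x. ennreal (shift_lr a x) \<partial>std_normal_distribution)
      = emeasure (density std_normal_distribution (\<lambda>x. ennreal (shift_lr a x))) UNIV"
    by (simp add: emeasure_density)
  also have "\<dots> = emeasure (distr std_normal_distribution std_normal_distribution (\<lambda>x. a + x)) UNIV"
    by (simp only: std_normal_shift)
  also have "\<dots> = 1"
    using N.emeasure_space_1 by (simp add: emeasure_distr)
  finally show ?thesis .
qed

lemma has_bochner_integral_shift_lr:
  "has_bochner_integral std_normal_distribution (shift_lr a) 1"
  using nn_integral_shift_lr by (intro has_bochner_integral_nn_integral) auto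

text \<open>
  The likelihood ratio of the mixture of the shifts by \<open>a\<close> and \<open>- a\<close>, equal to
  \<open>exp (- a ^ 2 / 2) * cosh (a * x)\<close>. It is written as a sum over signs so that a product of such
  factors expands by distributivity.
\<close>

definition sym_lr :: "real \<Rightarrow> real \<Rightarrow> real" where
  "sym_lr a x = (\<Sum>s\<in>{-1, 1}. shift_lr (s * a) x / 2)"

lemma has_bochner_integral_sym_lr:
  "has_bochner_integral std_normal_distribution (sym_lr a) 1"
proof -
  have "has_bochner_integral std_normal_distribution
      (\<lambda>x. shift_lr (- a) x * (1/2) + shift_lr a x * (1/2)) (1 * (1/2) + 1 * (1/2))"
    by (intro has_bochner_integral_add has_bochner_integral_mult_left has_bochner_integral_shift_lr)
  then show ?thesis by (simp add: sym_lr_def[abs_def])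
qed

text \<open>
  The four products in the expanded square have means \<open>exp (a\<^sup>2)\<close> (equal signs, twice) and
  \<open>exp (- a\<^sup>2)\<close> (opposite signs, twice). The linear terms in \<open>a\<^sup>2\<close> cancel, which is what makes the
  critical radius depend on fourth powers.
\<close>

lemma has_bochner_integral_sym_lr_square:
  "has_bochner_integral std_normal_distribution (\<lambda>x. (sym_lr a x)\<^sup>2) (cosh (a\<^sup>2))"
proof -
  have "(sym_lr a x)\<^sup>2 = shift_lr (a + a) x * (exp (a\<^sup>2) / 4) + shift_lr (- a + - a) x * (exp (a\<^sup>2) / 4)
      + exp (- a\<^sup>2) / 2" for x
    using shift_lr_mult[of a x a] shift_lr_mult[of a x "- a"] shift_lr_mult[of "- a" x "- a"]
    by (simp add: sym_lr_def power2_eq_square algebra_simps)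
  moreover have "has_bochner_integral std_normal_distribution
      (\<lambda>x. shift_lr (a + a) x * (exp (a\<^sup>2) / 4) + shift_lr (- a + - a) x * (exp (a\<^sup>2) / 4) + shift_lr 0 x * (exp (- a\<^sup>2) / 2))
      (1 * (exp (a\<^sup>2) / 4) + 1 * (exp (a\<^sup>2) / 4) + 1 * (exp (- a\<^sup>2) / 2))"
    by (intro has_bochner_integral_add has_bochner_integral_mult_left has_bochner_integral_shift_lr)
  ultimately show ?thesis by (simp add: cosh_field_def add_divide_distrib)
qed

lemma prod_sym_lr_eq_average:
  assumes "finite K"
  shows "(\<Prod>j\<in>K. sym_lr (a j) (x j))
    = (\<Sum>s\<in>K \<rightarrow>\<^sub>E {-1, 1}. \<Prod>j\<in>K. shift_lr (s j * a j) (x j)) / 2 ^ card K"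
  using assms unfolding sym_lr_def
  by (subst prod_sum_PiE) (auto simp: prod_dividef sum_divide_distrib)

lemma product_prob_space_std_normal: "product_prob_space (\<lambda>_. std_normal_distribution)"
proof -
  interpret prob_space std_normal_distribution by (rule prob_space_std_normal)
  show ?thesis by unfold_locales
qed

section \<open>Error probabilities in terms of the noise\<close>

text \<open>
  A Cameron-Martin formula. Only finitely many coordinates are shifted, so the likelihood ratio is a
  finite product even when \<open>J\<close> is infinite.
\<close>

lemma noise_law_shift:
  assumes K: "finite K" "K \<subseteq> J" and b: "\<And>j. j \<in> J - K \<Longrightarrow> b j = 0"
  shows "distr (noise_law J) (noise_law J) (\<lambda>x. \<lambda>j\<in>J. b j + x j)
    = density (noise_law J) (\<lambda>x. ennreal (\<Prod>j\<in>K. shift_lr (b j) (x j)))"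
proof -
  interpret product_prob_space "\<lambda>_. std_normal_distribution" J
    by (rule product_prob_space_std_normal)
  have "distr (noise_law J) (noise_law J) (\<lambda>x. \<lambda>j\<in>J. b j + x j)
      = PiM J (\<lambda>j. distr std_normal_distribution std_normal_distribution (\<lambda>x. b j + x))"
    unfolding noise_law_def by (intro distr_PiM_coordinatewise prob_space_std_normal) simp
  also have "\<dots> = density (noise_law J) (\<lambda>x. \<Prod>j\<in>K. ennreal (shift_lr (b j) (x j)))"
    unfolding std_normal_shift noise_law_def
    using b by (intro density_PiM_coordinates[symmetric] K nn_integral_shift_lr) auto
  finally show ?thesis by (simp add: prod_ennreal)
qed

lemma sets_noise_law [measurable_cong, simp]: "sets (noise_law J) = sets (seq_space J)"
  unfolding noise_law_def by (intro sets_PiM_cong) auto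

text \<open>
  Signals are parametrized as \<open>\<sigma> j * b j\<close> because the observation is then \<open>\<sigma> j * (b j + \<epsilon> j)\<close>:
  adding the signal amounts to shifting the noise before scaling. The acceptance and
  rejection regions, pulled back to the noise space, do not depend on the signal.
\<close>

lemma test_prob_eq_integral:
  assumes \<Phi>: "\<Phi> \<in> tests J" and i: "i \<in> {0, 1}"
    and K: "finite K" "K \<subseteq> J" and b: "\<And>j. j \<in> J - K \<Longrightarrow> b j = 0"
  shows "test_prob J \<sigma> (\<lambda>j\<in>J. \<sigma> j * b j) \<Phi> i
    = (\<integral>x\<in>{x \<in> space (noise_law J). \<Phi> (\<lambda>j\<in>J. \<sigma> j * x j) = i}.
        (\<Prod>j\<in>K. shift_lr (b j) (x j)) \<partial>noise_law J)"
proof -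
  let ?P = "noise_law J" and ?L = "\<lambda>x. \<Prod>j\<in>K. shift_lr (b j) (x j)"
  let ?T = "\<lambda>x. \<lambda>j\<in>J. b j + x j" and ?S = "\<lambda>x. \<lambda>j\<in>J. \<sigma> j * x j"
  let ?B = "{x \<in> space ?P. \<Phi> (?S x) = i}" and ?A = "{y \<in> space (seq_space J). \<Phi> y = i}"
  have A: "?A \<in> sets (seq_space J)"
  proof -
    have "?A = \<Phi> -` {i} \<inter> space (seq_space J)" by auto
    then show ?thesis using \<Phi> i by (auto simp: tests_def intro!: measurable_sets)
  qed
  have S: "?S \<in> ?P \<rightarrow>\<^sub>M seq_space J"
    unfolding measurable_cong_sets[OF sets_noise_law refl] by (intro measurable_restrict) measurable
  have T: "?T \<in> ?P \<rightarrow>\<^sub>M ?P"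
    unfolding measurable_cong_sets[OF sets_noise_law sets_noise_law] by (intro measurable_restrict) measurable
  have L: "?L \<in> borel_measurable ?P"
    unfolding measurable_cong_sets[OF sets_noise_law refl] using K(2)
    by (intro borel_measurable_prod measurable_compose[OF measurable_component_singleton]) auto
  have S': "?S \<in> density ?P ?L \<rightarrow>\<^sub>M seq_space J"
    using S by simp
  have SB: "?S -` ?A \<inter> space ?P = ?B"
    using measurable_space[OF S] by auto
  have B: "?B \<in> sets ?P"
    using measurable_sets[OF S A] by (simp only: SB)
  have shift: "distr ?P ?P ?T = density ?P ?L"
    using K b by (rule noise_law_shift)
  have "obs_law J \<sigma> (\<lambda>j\<in>J. \<sigma> j * b j) = distr ?P (seq_space J) (?S \<circ> ?T)"
    unfolding obs_law_def
    by (rule arg_cong[where f = "distr ?P (seq_space J)"]) (auto simp: fun_eq_iff algebra_simps)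
  also have "\<dots> = distr (density ?P ?L) (seq_space J) ?S"
    unfolding shift[symmetric] using S T by (rule distr_distr[symmetric])
  finally have "test_prob J \<sigma> (\<lambda>j\<in>J. \<sigma> j * b j) \<Phi> i = measure (distr (density ?P ?L) (seq_space J) ?S) ?A"
    by (simp add: test_prob_def)
  also have "\<dots> = measure (density ?P ?L) ?B"
    by (simp only: measure_distr[OF S' A] space_density SB)
  also have "\<dots> = enn2real (\<integral>\<^sup>+x. ennreal (indicator ?B x * ?L x) \<partial>?P)"
    unfolding measure_def using L B
    by (subst emeasure_density) (auto simp: indicator_def intro!: arg_cong[where f = enn2real] nn_integral_cong)
  also have "\<dots> = (\<integral>x\<in>?B. ?L x \<partial>?P)"
    unfolding set_lebesgue_integral_def using L B
    by (subst integral_eq_nn_integral) (auto intro!: AE_I2 mult_nonneg_nonneg prod_nonneg)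
  finally show ?thesis .
qed

section \<open>A mixture of alternatives close to the null hypothesis\<close>

text \<open>
  The average of the type II errors over all signs is the integral over the acceptance region
  \<open>B 0\<close> of the likelihood ratio \<open>L\<close> of the mixture. It is at least \<open>\<beta>\<close> by the second
  moment method, and the maximum over the signs is at least the average.
\<close>

lemma exists_sign_type_II_error_ge:
  assumes \<Phi>: "\<Phi> \<in> level_tests J \<sigma> \<alpha>" and K: "finite K" "K \<subseteq> J"
    and a: "(\<Sum>j\<in>K. a j ^ 4) \<le> 2 * ln (1 + 4 * (1 - \<alpha> - \<beta>)\<^sup>2)" and \<beta>: "\<beta> \<le> 1 - \<alpha>"
  obtains s where "s \<in> K \<rightarrow>\<^sub>E {-1, 1}"
    and "test_prob J \<sigma> (\<lambda>j\<in>J. \<sigma> j * (if j \<in> K then s j * a j else 0)) \<Phi> 0 \<ge> \<beta>"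
proof -
  interpret Q: product_prob_space "\<lambda>_. std_normal_distribution" J
    by (rule product_prob_space_std_normal)
  let ?P = "noise_law J" and ?S = "K \<rightarrow>\<^sub>E {-1, 1::real}"
  interpret P: prob_space ?P
    unfolding noise_law_def by (rule prob_space_PiM) (rule prob_space_std_normal)
  define b where "b s j = (if j \<in> K then s j * a j else 0)" for s j
  define B where "B i = {x \<in> space ?P. \<Phi> (\<lambda>j\<in>J. \<sigma> j * x j) = i}" for i :: nat
  define L where "L x = (\<Prod>j\<in>K. sym_lr (a j) (x j))" for x
  have tst: "\<Phi> \<in> tests J" and level: "test_prob J \<sigma> (\<lambda>j\<in>J. 0) \<Phi> 1 \<le> \<alpha>"
    using \<Phi> by (auto simp: level_tests_def)
  have \<Phi>_meas: "(\<lambda>x. \<Phi> (\<lambda>j\<in>J. \<sigma> j * x j)) \<in> ?P \<rightarrow>\<^sub>M count_space {0, 1}"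
  proof (rule measurable_compose[OF _ tst[unfolded tests_def]])
    show "(\<lambda>x. \<lambda>j\<in>J. \<sigma> j * x j) \<in> ?P \<rightarrow>\<^sub>M seq_space J"
      unfolding measurable_cong_sets[OF sets_noise_law refl] by (intro measurable_restrict) measurable
  qed
  have B: "B i \<in> P.events" if "i \<in> {0, 1}" for i
  proof -
    have "B i = (\<lambda>x. \<Phi> (\<lambda>j\<in>J. \<sigma> j * x j)) -` {i} \<inter> space ?P" by (auto simp: B_def)
    then show ?thesis using that measurable_sets[OF \<Phi>_meas, of "{i}"] by auto
  qed
  \<comment> \<open>The null hypothesis is the empty shift, whose likelihood ratio is the empty product.\<close>
  have null: "P.prob (B 1) \<le> \<alpha>"
    using level test_prob_eq_integral[OF tst, of 1 "{}" "\<lambda>_. 0" \<sigma>] B[of 1]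
    by (simp add: B_def set_lebesgue_integral_def)
  have "B 0 = space ?P - B 1"
    using measurable_space[OF \<Phi>_meas] by (auto simp: B_def)
  then have accept: "1 - \<alpha> \<le> P.prob (B 0)"
    using null B[of 1] by (simp add: P.prob_compl)

  have L: "has_bochner_integral ?P L 1"
    unfolding has_bochner_integral_iff L_def noise_law_def
    using Q.integrable_prod_coordinates[OF K, of "\<lambda>j. sym_lr (a j)"] Q.integral_prod_coordinates[OF K, of "\<lambda>j. sym_lr (a j)"]
      has_bochner_integral_sym_lr
    by (simp add: has_bochner_integral_iff)
  have L2: "has_bochner_integral ?P (\<lambda>x. (L x)\<^sup>2) (\<Prod>j\<in>K. cosh ((a j)\<^sup>2))"
    unfolding has_bochner_integral_iff L_def noise_law_def prod_power_distrib
    using Q.integrable_prod_coordinates[OF K, of "\<lambda>j y. (sym_lr (a j) y)\<^sup>2"]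
      Q.integral_prod_coordinates[OF K, of "\<lambda>j y. (sym_lr (a j) y)\<^sup>2"] has_bochner_integral_sym_lr_square
    by (simp add: has_bochner_integral_iff)
  have pos: "0 < 1 + 4 * (1 - \<alpha> - \<beta>)\<^sup>2"
    by (simp add: add_pos_nonneg)
  have "(\<Prod>j\<in>K. cosh ((a j)\<^sup>2)) \<le> (\<Prod>j\<in>K. exp (a j ^ 4 / 2))"
    using cosh_le_exp_half_square[of "(a _)\<^sup>2"] by (intro prod_mono) (auto simp flip: power_mult)
  also have "\<dots> = exp ((\<Sum>j\<in>K. a j ^ 4) / 2)"
    using K by (simp add: exp_sum sum_divide_distrib)
  also have "\<dots> \<le> exp (ln (1 + 4 * (1 - \<alpha> - \<beta>)\<^sup>2))"
    using a by simp
  also have "\<dots> = 1 + (2 * (1 - \<alpha> - \<beta>)) ^ 2"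
    unfolding exp_ln[OF pos] power_mult_distrib by simp
  finally have "sqrt ((\<Prod>j\<in>K. cosh ((a j)\<^sup>2)) - 1) \<le> 2 * (1 - \<alpha> - \<beta>)"
    using \<beta> by (intro real_le_lsqrt) auto
  moreover have "P.prob (B 0) - (\<integral>x\<in>B 0. L x \<partial>?P) \<le> sqrt ((\<Prod>j\<in>K. cosh ((a j)\<^sup>2)) - 1) / 2"
    using P.prob_diff_le_half_second_moment[of L "B 0"] L L2 B[of 0] by (simp add: has_bochner_integral_iff)
  ultimately have ge: "\<beta> \<le> (\<integral>x\<in>B 0. L x \<partial>?P)"
    using accept by simp

  let ?t = "\<lambda>s. test_prob J \<sigma> (\<lambda>j\<in>J. \<sigma> j * b s j) \<Phi> 0"
  have t: "?t s = (\<integral>x\<in>B 0. (\<Prod>j\<in>K. shift_lr (s j * a j) (x j)) \<partial>?P)" for s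
    unfolding B_def using test_prob_eq_integral[OF tst _ K, of 0 "b s" \<sigma>] by (simp add: b_def)
  have int: "set_integrable ?P (B 0) (\<lambda>x. \<Prod>j\<in>K. shift_lr (s j * a j) (x j))" for s
    unfolding set_integrable_def using B[of 0] has_bochner_integral_shift_lr
    by (intro integrable_mult_indicator)
      (auto simp: noise_law_def has_bochner_integral_iff intro!: Q.integrable_prod_coordinates K)
  have fin: "finite ?S" using K by (intro finite_PiE) auto
  have "(\<integral>x\<in>B 0. L x \<partial>?P) = (\<Sum>s\<in>?S. ?t s) / 2 ^ card K"
    unfolding L_def prod_sym_lr_eq_average[OF K(1)] t
    using int fin by (simp add: set_lebesgue_integral_def set_integrable_def sum_distrib_left sum_divide_distrib
      Bochner_Integration.integral_sum)
  with ge have sum: "2 ^ card K * \<beta> \<le> (\<Sum>s\<in>?S. ?t s)"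
    by (simp add: field_simps)
  have "card ?S = 2 ^ card K"
    using K by (simp add: card_PiE numeral_2_eq_2)
  have "\<exists>s\<in>?S. \<beta> \<le> ?t s"
  proof (rule ccontr)
    assume "\<not> ?thesis"
    then have "(\<Sum>s\<in>?S. ?t s) < (\<Sum>s\<in>?S. \<beta>)"
      using fin by (intro sum_strict_mono) (auto simp: PiE_eq_empty_iff)
    then show False using sum \<open>card ?S = 2 ^ card K\<close> by simp
  qed
  then show thesis using that unfolding b_def by blast
qed

section \<open>The least favourable signals\<close>

lemma l2_norm_finite_support:
  assumes "finite K" "K \<subseteq> J" "\<And>j. j \<in> J - K \<Longrightarrow> \<theta> j = 0"
  shows "l2_norm J \<theta> = sqrt (\<Sum>j\<in>K. (\<theta> j)\<^sup>2)"
proof -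
  have "infsum (\<lambda>j. (\<theta> j)\<^sup>2) J = infsum (\<lambda>j. (\<theta> j)\<^sup>2) K"
    using assms by (intro infsum_cong_neutral) auto
  then show ?thesis using assms by (simp add: l2_norm_def)
qed

lemma mem_l2_space_finite_support:
  assumes "finite K" "K \<subseteq> J" "\<And>j. j \<in> J - K \<Longrightarrow> \<theta> j = 0" "\<theta> \<in> extensional J"
  shows "\<theta> \<in> l2_space J"
proof -
  have "(\<lambda>j. (\<theta> j)\<^sup>2) summable_on J \<longleftrightarrow> (\<lambda>j. (\<theta> j)\<^sup>2) summable_on K"
    using assms by (intro summable_on_cong_neutral) auto
  then show ?thesis using assms by (simp add: l2_space_def)
qed

text \<open>
  The shift \<open>a j\<close> is proportional to \<open>\<sigma> j\<close> because, for a signal of given norm, this choice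
  minimizes \<open>\<Sum>j. a j ^ 4\<close>: by Cauchy-Schwarz, \<open>\<rho>\<^sup>2 = (\<Sum>j. \<sigma> j ^ 2 * a j ^ 2)\<close> forces
  \<open>(\<Sum>j. a j ^ 4) \<ge> \<rho> ^ 4 / V\<close>, and equality holds here.
\<close>

lemma exists_alternative_type_II_error_ge:
  assumes J: "{1..D} \<subseteq> J" "0 \<notin> J" and D: "1 \<le> D" and \<sigma>: "\<And>j. j \<in> {1..D} \<Longrightarrow> \<sigma> j > 0"
    and \<beta>: "\<beta> < 1 - \<alpha>" and \<rho>: "0 < \<rho>" "\<rho> \<le> rho_D \<sigma> \<alpha> \<beta> D"
    and \<Phi>: "\<Phi> \<in> level_tests J \<sigma> \<alpha>"
  obtains \<theta> where "\<theta> \<in> S_set J D" "l2_norm J \<theta> = \<rho>" "test_prob J \<sigma> \<theta> \<Phi> 0 \<ge> \<beta>"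
proof -
  define V where "V = (\<Sum>j=1..D. \<sigma> j ^ 4)"
  define a where "a j = \<sigma> j * \<rho> / sqrt V" for j
  have V: "V > 0"
    unfolding V_def using D by (intro sum_pos zero_less_power \<sigma>) auto
  have c: "0 \<le> 2 * ln (1 + 4 * (1 - \<alpha> - \<beta>)\<^sup>2)"
    by simp
  have rho2: "(rho_D \<sigma> \<alpha> \<beta> D)\<^sup>2 = sqrt (2 * ln (1 + 4 * (1 - \<alpha> - \<beta>)\<^sup>2)) * sqrt V"
    using c V by (simp add: rho_D_def c_const_def V_def)
  have "\<rho> ^ 4 \<le> rho_D \<sigma> \<alpha> \<beta> D ^ 4"
    using \<rho> by (intro power_mono) auto
  also have "\<dots> = ((rho_D \<sigma> \<alpha> \<beta> D)\<^sup>2)\<^sup>2"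
    by (simp flip: power_mult)
  also have "\<dots> = 2 * ln (1 + 4 * (1 - \<alpha> - \<beta>)\<^sup>2) * V"
    unfolding rho2 using c V by (simp add: power_mult_distrib)
  finally have \<rho>4: "\<rho> ^ 4 \<le> 2 * ln (1 + 4 * (1 - \<alpha> - \<beta>)\<^sup>2) * V" .
  have sqrtV4: "sqrt V ^ 4 = V\<^sup>2"
    using V power_mult[of "sqrt V" 2 2] by simp
  have "(\<Sum>j=1..D. a j ^ 4) = (\<Sum>j=1..D. \<sigma> j ^ 4 * (\<rho> ^ 4 / V\<^sup>2))"
    by (simp add: a_def power_divide power_mult_distrib sqrtV4)
  also have "\<dots> = V * \<rho> ^ 4 / V\<^sup>2"
    unfolding sum_distrib_right[symmetric] V_def[symmetric] by simp
  also have "\<dots> \<le> 2 * ln (1 + 4 * (1 - \<alpha> - \<beta>)\<^sup>2)"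
    using \<rho>4 V by (simp add: power2_eq_square field_simps)
  finally have a4: "(\<Sum>j=1..D. a j ^ 4) \<le> 2 * ln (1 + 4 * (1 - \<alpha> - \<beta>)\<^sup>2)" .
  obtain s where s: "s \<in> {1..D} \<rightarrow>\<^sub>E {-1, 1}"
    and ge: "test_prob J \<sigma> (\<lambda>j\<in>J. \<sigma> j * (if j \<in> {1..D} then s j * a j else 0)) \<Phi> 0 \<ge> \<beta>"
    using exists_sign_type_II_error_ge[OF \<Phi> _ J(1) a4] \<beta> by auto
  define \<theta> where "\<theta> = (\<lambda>j\<in>J. \<sigma> j * (if j \<in> {1..D} then s j * a j else 0))"
  have off: "\<theta> j = 0" if "j \<in> J - {1..D}" for j
    using that by (auto simp: \<theta>_def)
  have "\<theta> \<in> S_set J D"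
    using mem_l2_space_finite_support[of "{1..D}" J \<theta>] J off by (auto simp: S_set_def \<theta>_def)
  moreover have "l2_norm J \<theta> = \<rho>"
  proof -
    have sq: "(\<theta> j)\<^sup>2 = \<sigma> j ^ 4 * \<rho>\<^sup>2 / V" if "j \<in> {1..D}" for j
    proof -
      have "s j = -1 \<or> s j = 1" using s that by auto
      then have "(s j)\<^sup>2 = 1" by auto
      moreover have "\<sigma> j ^ 4 = (\<sigma> j)\<^sup>2 * (\<sigma> j)\<^sup>2" by (simp flip: power_add)
      ultimately show ?thesis
        using that J V by (auto simp: \<theta>_def a_def power_mult_distrib power_divide)
    qed
    have "(\<Sum>j=1..D. (\<theta> j)\<^sup>2) = V * \<rho>\<^sup>2 / V"
      by (simp add: sq V_def sum_distrib_right sum_divide_distrib)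
    then show ?thesis
      using l2_norm_finite_support[of "{1..D}" J \<theta>] J off V \<rho> by simp
  qed
  ultimately show thesis using that ge by (simp add: \<theta>_def)
qed

section \<open>The lower bound\<close>

lemma test_prob_1_eq:
  assumes "\<Phi> \<in> tests J"
  shows "test_prob J \<sigma> \<theta> \<Phi> 1 = 1 - test_prob J \<sigma> \<theta> \<Phi> 0"
proof -
  interpret N: prob_space "noise_law J"
    unfolding noise_law_def by (rule prob_space_PiM) (rule prob_space_std_normal)
  have m: "(\<lambda>\<epsilon>. \<lambda>j\<in>J. \<theta> j + \<sigma> j * \<epsilon> j) \<in> noise_law J \<rightarrow>\<^sub>M seq_space J"
    unfolding measurable_cong_sets[OF sets_noise_law refl] by (intro measurable_restrict) measurable
  interpret P: prob_space "obs_law J \<sigma> \<theta>"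
    unfolding obs_law_def using m by (rule N.prob_space_distr)
  have \<Phi>: "\<Phi> \<in> obs_law J \<sigma> \<theta> \<rightarrow>\<^sub>M count_space {0, 1}"
    using assms by (simp add: tests_def obs_law_def)
  have "{y \<in> space (obs_law J \<sigma> \<theta>). \<Phi> y = 0} = \<Phi> -` {0} \<inter> space (obs_law J \<sigma> \<theta>)"
    by auto
  then have "{y \<in> space (obs_law J \<sigma> \<theta>). \<Phi> y = 0} \<in> P.events"
    using measurable_sets[OF \<Phi>, of "{0}"] by simp
  moreover have "\<Phi> y = 1 \<longleftrightarrow> \<Phi> y \<noteq> 0" if "y \<in> space (obs_law J \<sigma> \<theta>)" for y
    using measurable_space[OF \<Phi> that] by auto
  then have "{y \<in> space (obs_law J \<sigma> \<theta>). \<Phi> y = 1}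
      = space (obs_law J \<sigma> \<theta>) - {y \<in> space (obs_law J \<sigma> \<theta>). \<Phi> y = 0}"
    by blast
  ultimately show ?thesis
    unfolding test_prob_def by (simp add: P.prob_compl)
qed

theorem proposition1:
  fixes J :: "nat set" and \<sigma> :: "nat \<Rightarrow> real" and \<alpha> \<beta> :: real and D :: nat
  assumes "(\<exists>N\<ge>1. J = {1..N} \<and> D \<le> N) \<or> J = {1..}"
    and "\<And>j. j \<in> J \<Longrightarrow> \<sigma> j > 0"
    and "0 < \<alpha>" and "\<alpha> < 1"
    and "0 < \<beta>" and "\<beta> < 1 - \<alpha>"
    and "1 \<le> D"
  shows "(\<forall>\<rho>. 0 < \<rho> \<and> \<rho> \<le> rho_D \<sigma> \<alpha> \<beta> D \<longrightarrow>
           (INF \<Phi> \<in> level_tests J \<sigma> \<alpha>.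
              SUP \<theta> \<in> {\<theta> \<in> S_set J D. l2_norm J \<theta> = \<rho>}. ereal (test_prob J \<sigma> \<theta> \<Phi> 0)) \<ge> ereal \<beta>)
         \<and> minimax_rate J \<sigma> (S_set J D) \<alpha> \<beta> \<ge> ereal (rho_D \<sigma> \<alpha> \<beta> D)"
proof
  have J: "{1..D} \<subseteq> J" "0 \<notin> J"
    using assms(1) by auto
  have \<sigma>: "\<sigma> j > 0" if "j \<in> {1..D}" for j
    using that J assms(2) by blast
  note hard = exists_alternative_type_II_error_ge[where \<sigma> = \<sigma>, OF J \<open>1 \<le> D\<close> \<sigma> \<open>\<beta> < 1 - \<alpha>\<close>]
  show "\<forall>\<rho>. 0 < \<rho> \<and> \<rho> \<le> rho_D \<sigma> \<alpha> \<beta> D \<longrightarrow>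
      (INF \<Phi> \<in> level_tests J \<sigma> \<alpha>.
        SUP \<theta> \<in> {\<theta> \<in> S_set J D. l2_norm J \<theta> = \<rho>}. ereal (test_prob J \<sigma> \<theta> \<Phi> 0)) \<ge> ereal \<beta>"
  proof (intro allI impI INF_greatest)
    fix \<rho> \<Phi> assume \<rho>: "0 < \<rho> \<and> \<rho> \<le> rho_D \<sigma> \<alpha> \<beta> D" and \<Phi>: "\<Phi> \<in> level_tests J \<sigma> \<alpha>"
    then obtain \<theta> where "\<theta> \<in> S_set J D" "l2_norm J \<theta> = \<rho>" "test_prob J \<sigma> \<theta> \<Phi> 0 \<ge> \<beta>"
      using hard by blast
    then show "ereal \<beta> \<le> (SUP \<theta> \<in> {\<theta> \<in> S_set J D. l2_norm J \<theta> = \<rho>}. ereal (test_prob J \<sigma> \<theta> \<Phi> 0))"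
      by (intro SUP_upper2[of \<theta>]) auto
  qed
  show "minimax_rate J \<sigma> (S_set J D) \<alpha> \<beta> \<ge> ereal (rho_D \<sigma> \<alpha> \<beta> D)"
    unfolding minimax_rate_def test_radius_def
  proof (intro INF_greatest)
    fix \<Phi> \<rho> assume \<Phi>: "\<Phi> \<in> level_tests J \<sigma> \<alpha>"
      and "\<rho> \<in> {\<rho>. 0 < \<rho> \<and> (INF \<theta> \<in> {\<theta> \<in> S_set J D. \<rho> \<le> l2_norm J \<theta>}.
        ereal (test_prob J \<sigma> \<theta> \<Phi> 1)) > ereal (1 - \<beta>)}"
    then have \<rho>: "0 < \<rho>" and power:
      "(INF \<theta> \<in> {\<theta> \<in> S_set J D. \<rho> \<le> l2_norm J \<theta>}. ereal (test_prob J \<sigma> \<theta> \<Phi> 1)) > ereal (1 - \<beta>)"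
      by auto
    show "ereal (rho_D \<sigma> \<alpha> \<beta> D) \<le> ereal \<rho>"
    proof (rule ccontr)
      assume "\<not> ?thesis"
      then have "\<rho> \<le> rho_D \<sigma> \<alpha> \<beta> D" by simp
      then obtain \<theta> where \<theta>: "\<theta> \<in> S_set J D" "l2_norm J \<theta> = \<rho>" "test_prob J \<sigma> \<theta> \<Phi> 0 \<ge> \<beta>"
        using hard[OF _ \<rho> _ \<Phi>] \<sigma> by blast
      have "(INF \<theta> \<in> {\<theta> \<in> S_set J D. \<rho> \<le> l2_norm J \<theta>}. ereal (test_prob J \<sigma> \<theta> \<Phi> 1))
          \<le> ereal (test_prob J \<sigma> \<theta> \<Phi> 1)"
        using \<theta> by (intro INF_lower) auto
      also have "\<dots> \<le> ereal (1 - \<beta>)"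
        using \<theta> test_prob_1_eq[of \<Phi> J \<sigma> \<theta>] \<Phi> by (simp add: level_tests_def)
      finally show False using power by simp
    qed
  qed
qed

end
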